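(* Let $c$ be the complex-valued function on the set $\mathcal M$ of isomorphism classes of Feynman graphs that is determined by the inversion equation (A) and the ansatz (B) given in the context. Let $\Gamma$ be a graph from $\mathcal M$ with $k$ special vertices $s_k>s_{k-1}>\dots>s_1$, and let $\sigma_i$, $0\le i\le k$, be the admissible partition of $\Gamma$ such that the graph $\Gamma_i=\Gamma_2^{\sigma_i}$ has $i$ special vertices $s_i>s_{i-1}>\dots>s_1$ and no frontal regular vertices. Let $l_i$ be the length of the longest chain $s_i>s_{i-1}>\dots$ of frontal special vertices in the graph $\Gamma_i$. Let $R(\Gamma)$ be the number of regular internal vertices of $\Gamma$. If $\Gamma$ has no special vertices, then $$c(\Gamma)=(-1)^{R(\Gamma)}.$$ If $k\ge1$, then $$c(\Gamma)=\sum_{n=0}^{k-1}\ \sum_{k_0,\dots,k_{n+1}}\frac{(-1)^{R(\Gamma)+n+1}}{(k_0-k_1)!\,(k_1-k_2)!\cdots(k_n-k_{n+1})!},$$ where the summation in the inner sum is over the $(n+2)$-tuples of integers $(k_0,\dots,k_{n+1})$ such that $k_0=k$, $k_{n+1}=0$, and $l_{k_i}\ge k_i-k_{i+1}\ge1$ for $0\le i\le n$.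
   Context: Graphs. A graph from $\mathcal M$ is a directed graph with multiple edges allowed and without directed cycles. It has two external vertices, the source $\mathbf{in}$ (no incoming edges) and the sink $\mathbf{out}$ (no outgoing edges), and a possibly empty finite set of internal vertices, each of which is either regular or special. A regular vertex carries an integer weight $r\ge-1$. The special vertices are linearly ordered, and if there is a directed path from a special vertex $s$ to another special vertex $s'$ (possibly through regular vertices), then $s>s'$. Each internal vertex has at least one incoming and at least one outgoing edge, and a regular vertex of weight $-1$ has at least three incident edges in total. Isomorphisms respect the source, the sink, the regular vertices and their weights, and the special vertices and their linear order. $\mathcal M$ is the set of isomorphism classes, and functions on $\mathcal M$ are written as functions of graphs. $\mathcal N\subset\mathcal M$ consists of the classes of graphs with no edges connecting internal vertices. For a graph $\Gamma$, $\mathbf s(\Gamma)$ is the number of special vertices, $R(\Gamma)$ the number of regular internal vertices, and $\mathbf q(\Gamma)$ the degree of the source. $\Lambda_n$ ($n\ge0$) is the graph with no internal vertices and $n$ edges. An internal vertex is called frontal if all its incoming edges come from the source. Admissible partitions. An admissible partition $\pi$ of $\Gamma$ is a partition of the set of internal vertices into two (possibly empty) sets $V_1^\pi,V_2^\pi$ such that each special vertex from $V_1^\pi$ is greater than every special vertex from $V_2^\pi$, and every edge connecting $\{\mathbf{in}\}\cup V_1^\pi$ with $V_2^\pi\cup\{\mathbf{out}\}$ has its tail in $\{\mathbf{in}\}\cup V_1^\pi$ and its head in $V_2^\pi\cup\{\mathbf{out}\}$. The graph $\Gamma_1^\pi$ is obtained from $\Gamma$ by removing the vertices of $V_2^\pi$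 and the edges between vertices of $V_2^\pi\cup\{\mathbf{out}\}$, and connecting the loose ends to the sink. The graph $\Gamma_2^\pi$ is obtained from $\Gamma$ by removing the vertices of $V_1^\pi$ and the edges between vertices of $\{\mathbf{in}\}\cup V_1^\pi$, and connecting the loose ends to the source. Both are graphs from $\mathcal M$, with the inherited order on special vertices. If $\Gamma$ has $k$ special vertices, then for each $0\le i\le k$ there is a unique admissible partition $\sigma_i$ of $\Gamma$ such that $\Gamma_2^{\sigma_i}$ has no regular frontal vertices and exactly $i$ special vertices. Here $V_2^{\sigma_i}$ consists of $s_i,\dots,s_1$ and of all regular vertices that can be reached from them by directed paths. Chains. $l_i$ is the largest $l$ such that the $l$ consecutive special vertices $s_i,s_{i-1},\dots,s_{i-l+1}$ are all frontal in $\Gamma_i$ ($l_i=0$ if $s_i$ is not frontal in $\Gamma_i$ or $i=0$). The function $c$. Put $d(\Lambda_n)=n!$ and $d(\Gamma)=0$ if $\Gamma$ has at least one internal vertex. The function $c$ on $\mathcal M$ is required to satisfy: (A) for every graph $\Gamma$ from $\mathcal M$, $$d(\Gamma)=\mathbf q(\Gamma)!\sum_\pi\frac{c(\Gamma_2^\pi)}{\mathbf s(\Gamma_1^\pi)!},$$ where the sum is over the admissible partitions $\pi$ of $\Gamma$ such that $\Gamma_1^\pi$ is from $\mathcal N$ (in particular $c(\Lambda_n)=1$); (B) for every graph $\Gamma$ from $\mathcal M$ with $k$ special vertices, $c(\Gamma)=(-1)^{R(\Gamma)-R(\tilde\Gamma)}c(\tilde\Gamma)$, where $\tilde\Gamma=\Gamma_2^{\sigma_k}$.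 These conditions determine $c$ uniquely. (The function $c$ arises as the system of coefficients sought in a graph expansion of a star product with separation of variables on the endomorphism bundle of the dual of a holomorphic Hermitian vector bundle; only the combinatorial definition above is needed here.) *)

theory Defs
  imports Complex_Main "HOL-Library.Multiset"
begin

datatype 'v vertex = In | Out | Inner 'v

text \<open>
  Parallel edges are recorded by multiplicity in \<^term>\<open>edges\<close>, an edge being the pair of its tail
  and its head. The domain of \<^term>\<open>weight\<close> is the set of regular vertices, and the special
  vertices with their linear order are listed increasingly: \<^term>\<open>specials\<close> is
  \<open>[s\<^sub>1, \<dots>, s\<^sub>k]\<close> with \<open>s\<^sub>1 < \<dots> < s\<^sub>k\<close>.
\<close>

record 'v feynman_graph =
  edges :: "('v vertex \<times> 'v vertex) multiset"
  weight :: "'v \<rightharpoonup> int"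
  specials :: "'v list"

definition regulars :: "'v feynman_graph \<Rightarrow> 'v set" where
  "regulars \<Gamma> = dom (weight \<Gamma>)"

definition internals :: "'v feynman_graph \<Rightarrow> 'v set" where
  "internals \<Gamma> = regulars \<Gamma> \<union> set (specials \<Gamma>)"

definition in_deg :: "'v feynman_graph \<Rightarrow> 'v vertex \<Rightarrow> nat" where
  "in_deg \<Gamma> x = size {# e \<in># edges \<Gamma>. snd e = x #}"

definition out_deg :: "'v feynman_graph \<Rightarrow> 'v vertex \<Rightarrow> nat" where
  "out_deg \<Gamma> x = size {# e \<in># edges \<Gamma>. fst e = x #}"

definition special_less :: "'v feynman_graph \<Rightarrow> 'v \<Rightarrow> 'v \<Rightarrow> bool" where
  "special_less \<Gamma> s t \<longleftrightarrow>
     (\<exists>i j. i < j \<and> j < length (specials \<Gamma>) \<and> specials \<Gamma> ! i = s \<and> specials \<Gamma> ! j = t)"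

text \<open>
  The representatives of the elements of the set \<open>\<M>\<close> of isomorphism classes; a function on \<open>\<M>\<close> is a
  function of graphs that is invariant under \<open>isomorphic\<close> below.
\<close>

definition from_M :: "'v feynman_graph \<Rightarrow> bool" where
  "from_M \<Gamma> \<longleftrightarrow>
     finite (regulars \<Gamma>) \<and> distinct (specials \<Gamma>) \<and> regulars \<Gamma> \<inter> set (specials \<Gamma>) = {} \<and>
     (\<forall>(x, y) \<in># edges \<Gamma>. x \<in> insert In (Inner ` internals \<Gamma>) \<and> y \<in> insert Out (Inner ` internals \<Gamma>)) \<and>
     acyclic (set_mset (edges \<Gamma>)) \<and>
     (\<forall>s \<in> set (specials \<Gamma>). \<forall>t \<in> set (specials \<Gamma>).
        (Inner s, Inner t) \<in> (set_mset (edges \<Gamma>))\<^sup>+ \<longrightarrow> special_less \<Gamma> t s) \<and>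
     (\<forall>v \<in> internals \<Gamma>. in_deg \<Gamma> (Inner v) \<ge> 1 \<and> out_deg \<Gamma> (Inner v) \<ge> 1) \<and>
     (\<forall>v r. weight \<Gamma> v = Some r \<longrightarrow>
        r \<ge> -1 \<and> (r = -1 \<longrightarrow> in_deg \<Gamma> (Inner v) + out_deg \<Gamma> (Inner v) \<ge> 3))"

definition isomorphic :: "'v feynman_graph \<Rightarrow> 'v feynman_graph \<Rightarrow> bool" where
  "isomorphic \<Gamma> \<Delta> \<longleftrightarrow>
     (\<exists>f. bij_betw f (internals \<Gamma>) (internals \<Delta>) \<and>
          edges \<Delta> = image_mset (map_prod (map_vertex f) (map_vertex f)) (edges \<Gamma>) \<and>
          (\<forall>v \<in> internals \<Gamma>. weight \<Delta> (f v) = weight \<Gamma> v) \<and>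
          specials \<Delta> = map f (specials \<Gamma>))"

definition from_N :: "'v feynman_graph \<Rightarrow> bool" where
  "from_N \<Gamma> \<longleftrightarrow> from_M \<Gamma> \<and> (\<forall>u v. (Inner u, Inner v) \<notin># edges \<Gamma>)"

definition num_special :: "'v feynman_graph \<Rightarrow> nat" where
  "num_special \<Gamma> = length (specials \<Gamma>)"

definition num_regular :: "'v feynman_graph \<Rightarrow> nat" where
  "num_regular \<Gamma> = card (regulars \<Gamma>)"

definition source_degree :: "'v feynman_graph \<Rightarrow> nat" where
  "source_degree \<Gamma> = out_deg \<Gamma> In"

definition Lambda :: "nat \<Rightarrow> 'v feynman_graph" where
  "Lambda n = \<lparr>edges = replicate_mset n (In, Out), weight = Map.empty, specials = []\<rparr>"

definition frontal :: "'v feynman_graph \<Rightarrow> 'v \<Rightarrow> bool" where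
  "frontal \<Gamma> v \<longleftrightarrow> v \<in> internals \<Gamma> \<and> (\<forall>x. (x, Inner v) \<in># edges \<Gamma> \<longrightarrow> x = In)"

text \<open>A partition is the ordered pair of its two parts \<open>(V\<^sub>1, V\<^sub>2)\<close>.\<close>

definition admissible :: "'v feynman_graph \<Rightarrow> 'v set \<times> 'v set \<Rightarrow> bool" where
  "admissible \<Gamma> \<pi> \<longleftrightarrow>
     (let V1 = fst \<pi>; V2 = snd \<pi>;
          A = insert In (Inner ` V1); B = insert Out (Inner ` V2)
      in V1 \<union> V2 = internals \<Gamma> \<and> V1 \<inter> V2 = {} \<and>
         (\<forall>s \<in> V1 \<inter> set (specials \<Gamma>). \<forall>t \<in> V2 \<inter> set (specials \<Gamma>). special_less \<Gamma> t s) \<and>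
         (\<forall>(x, y) \<in># edges \<Gamma>. x \<in> A \<and> y \<in> B \<or> x \<in> B \<and> y \<in> A \<longrightarrow> x \<in> A \<and> y \<in> B))"

definition part1 :: "'v feynman_graph \<Rightarrow> 'v set \<times> 'v set \<Rightarrow> 'v feynman_graph" where
  "part1 \<Gamma> \<pi> =
     (let V1 = fst \<pi>; V2 = snd \<pi>; B = insert Out (Inner ` V2);
          h = (\<lambda>x. if x \<in> Inner ` V2 then Out else x)
      in \<lparr>edges = image_mset (map_prod h h) {# e \<in># edges \<Gamma>. \<not> (fst e \<in> B \<and> snd e \<in> B) #},
          weight = weight \<Gamma> |` V1,
          specials = filter (\<lambda>v. v \<in> V1) (specials \<Gamma>)\<rparr>)"

definition part2 :: "'v feynman_graph \<Rightarrow> 'v set \<times> 'v set \<Rightarrow> 'v feynman_graph" where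
  "part2 \<Gamma> \<pi> =
     (let V1 = fst \<pi>; V2 = snd \<pi>; A = insert In (Inner ` V1);
          h = (\<lambda>x. if x \<in> Inner ` V1 then In else x)
      in \<lparr>edges = image_mset (map_prod h h) {# e \<in># edges \<Gamma>. \<not> (fst e \<in> A \<and> snd e \<in> A) #},
          weight = weight \<Gamma> |` V2,
          specials = filter (\<lambda>v. v \<in> V2) (specials \<Gamma>)\<rparr>)"

text \<open>
  For \<open>\<Gamma>\<close> from \<open>\<M>\<close> and \<open>i \<le> num_special \<Gamma>\<close> there is exactly one such partition.
\<close>

definition sigma :: "'v feynman_graph \<Rightarrow> nat \<Rightarrow> 'v set \<times> 'v set" where
  "sigma \<Gamma> i =
     (THE \<pi>. admissible \<Gamma> \<pi> \<and> num_special (part2 \<Gamma> \<pi>) = i \<and>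
             (\<forall>v \<in> regulars (part2 \<Gamma> \<pi>). \<not> frontal (part2 \<Gamma> \<pi>) v))"

definition tail_graph :: "'v feynman_graph \<Rightarrow> nat \<Rightarrow> 'v feynman_graph" where
  "tail_graph \<Gamma> i = part2 \<Gamma> (sigma \<Gamma> i)"

text \<open>
  The length \<open>l\<^sub>i\<close>: the list entry with index \<open>j\<close> (counted from \<open>0\<close>) is \<open>s\<^bsub>j+1\<^esub>\<close>, so the indices
  \<open>i - l, \<dots>, i - 1\<close> stand for \<open>s\<^bsub>i-l+1\<^esub>, \<dots>, s\<^sub>i\<close>.
\<close>

definition chain_length :: "'v feynman_graph \<Rightarrow> nat \<Rightarrow> nat" where
  "chain_length \<Gamma> i =
     Max {l. l \<le> i \<and> (\<forall>j \<in> {i - l..<i}. frontal (tail_graph \<Gamma> i) (specials \<Gamma> ! j))}"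

definition iso_invariant :: "('v feynman_graph \<Rightarrow> complex) \<Rightarrow> bool" where
  "iso_invariant c \<longleftrightarrow>
     (\<forall>\<Gamma> \<Delta>. from_M \<Gamma> \<and> from_M \<Delta> \<and> isomorphic \<Gamma> \<Delta> \<longrightarrow> c \<Gamma> = c \<Delta>)"

definition d_fun :: "'v feynman_graph \<Rightarrow> complex" where
  "d_fun \<Gamma> = (if internals \<Gamma> = {} then fact (source_degree \<Gamma>) else 0)"

definition inversion_equation :: "('v feynman_graph \<Rightarrow> complex) \<Rightarrow> bool" where
  "inversion_equation c \<longleftrightarrow>
     (\<forall>\<Gamma>. from_M \<Gamma> \<longrightarrow>
        d_fun \<Gamma> = fact (source_degree \<Gamma>) *
          (\<Sum>\<pi> | admissible \<Gamma> \<pi> \<and> from_N (part1 \<Gamma> \<pi>). c (part2 \<Gamma> \<pi>) / fact (num_special (part1 \<Gamma> \<pi>))))"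

text \<open>
  The natural-number difference in the exponent does not truncate, since the regular vertices of
  \<open>part2 \<Gamma> \<pi>\<close> are among those of \<open>\<Gamma>\<close>.
\<close>

definition sign_ansatz :: "('v feynman_graph \<Rightarrow> complex) \<Rightarrow> bool" where
  "sign_ansatz c \<longleftrightarrow>
     (\<forall>\<Gamma>. from_M \<Gamma> \<longrightarrow>
        (let \<Delta> = tail_graph \<Gamma> (num_special \<Gamma>)
         in c \<Gamma> = (-1) ^ (num_regular \<Gamma> - num_regular \<Delta>) * c \<Delta>))"

text \<open>
  Tuples \<open>(k\<^sub>0, \<dots>, k\<^bsub>n+1\<^esub>)\<close> as lists. Natural numbers suffice: the entries strictly decrease to \<open>0\<close>,
  and the condition \<open>\<ge> 1\<close> keeps the differences from truncating.
\<close>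

definition chain_tuples :: "'v feynman_graph \<Rightarrow> nat \<Rightarrow> nat list set" where
  "chain_tuples \<Gamma> n =
     {ks. length ks = n + 2 \<and> ks ! 0 = num_special \<Gamma> \<and> ks ! (n + 1) = 0 \<and>
          (\<forall>i \<le> n. chain_length \<Gamma> (ks ! i) \<ge> ks ! i - ks ! (i + 1) \<and> ks ! i - ks ! (i + 1) \<ge> 1)}"

text \<open>The graphs without internal vertices are the \<open>Lambda n\<close>, with \<open>d_fun (Lambda n) = n!\<close>.\<close>

lemma from_M_Lambda: "from_M (Lambda n)"
proof -
  have "acyclic {(In :: 'a vertex, Out)}"
    by (rule acyclicI) (auto dest: tranclD tranclD2)
  then have "acyclic (set_mset (replicate_mset n (In :: 'a vertex, Out)))"
    by (rule acyclic_subset) auto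
  then show ?thesis
    by (auto simp: from_M_def Lambda_def regulars_def internals_def)
qed

lemma Lambda_unique:
  assumes "from_M \<Gamma>" and "internals \<Gamma> = {}"
  shows "\<Gamma> = Lambda (source_degree \<Gamma>)"
proof -
  have E: "e = (In, Out)" if "e \<in># edges \<Gamma>" for e
    using assms that by (cases e) (auto simp: from_M_def)
  then have "edges \<Gamma> = replicate_mset (size (edges \<Gamma>)) (In, Out)"
    by (metis set_mset_subset_singletonD insertI1 subsetI singleton_iff)
  moreover have "{# e \<in># edges \<Gamma>. fst e = In #} = edges \<Gamma>"
    using E by (auto simp: filter_mset_eq_conv)
  moreover have "weight \<Gamma> = Map.empty" "specials \<Gamma> = []"
    using assms(2) by (auto simp: internals_def regulars_def)
  ultimately show ?thesis
    by (cases \<Gamma>) (auto simp: Lambda_def source_degree_def out_deg_def)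
qed

lemma d_fun_Lambda: "d_fun (Lambda n) = fact n"
  by (simp add: d_fun_def Lambda_def internals_def regulars_def source_degree_def out_deg_def
      filter_mset_eq_conv[THEN iffD2, of "replicate_mset n (In, Out)" "replicate_mset n (In, Out)"])

end

theory Submission imports Defs begin

text \<open>
  A tail graph \<open>\<Gamma>\<^sub>i\<close> has no frontal regular vertices, so the partitions in its inversion equation
  are exactly those that split off the topmost \<open>j\<close> special vertices, \<open>0 \<le> j \<le> l\<^sub>i\<close>. Passing to
  \<open>\<Gamma>\<^sub>2\<close> and removing its frontal regular vertices leads to \<open>\<Gamma>\<^bsub>i-j\<^esub>\<close> itself, because tail graphs of
  a second part of \<open>\<Gamma>\<close> are tail graphs of \<open>\<Gamma>\<close>. Hence \<open>a\<^sub>i = (-1)\<^bsup>R(\<Gamma>\<^sub>i)\<^esup> c(\<Gamma>\<^sub>i)\<close> satisfies \<open>a\<^sub>0 = 1\<close> and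
  \<open>\<Sum>\<^bsub>j \<le> l\<^sub>i\<^esub> a\<^bsub>i-j\<^esub> / j! = 0\<close> for \<open>i \<ge> 1\<close>. Solving for \<open>a\<^sub>i\<close> and iterating gives the sum over the
  tuples, and \<open>c(\<Gamma>) = (-1)\<^bsup>R(\<Gamma>)\<^esup> a\<^sub>k\<close> by the sign ansatz.
\<close>

section \<open>Initial segments of lists, and acyclicity from a rank\<close>

lemma filter_eq_take:
  assumes "\<And>i j. \<lbrakk>i < j; j < length xs; P (xs ! j)\<rbrakk> \<Longrightarrow> P (xs ! i)"
  shows "filter P xs = take (length (filter P xs)) xs"
  using assms
proof (induction xs)
  case (Cons x xs)
  have IH: "filter P xs = take (length (filter P xs)) xs"
  proof (rule Cons.IH)
    fix i j assume "i < j" "j < length xs" "P (xs ! j)"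
    then show "P (xs ! i)" using Cons.prems[of "Suc i" "Suc j"] by simp
  qed
  show ?case
  proof (cases "P x")
    case True
    then show ?thesis using IH by simp
  next
    case False
    have "\<not> P y" if y: "y \<in> set xs" for y
    proof
      assume "P y"
      obtain j where "j < length xs" "xs ! j = y" using y by (auto simp: in_set_conv_nth)
      then show False using Cons.prems[of 0 "Suc j"] False \<open>P y\<close> by simp
    qed
    then have "filter P xs = []" by (simp add: filter_empty_conv)
    then show ?thesis using False by simp
  qed
qed simp

lemma filter_mem_take:
  assumes "distinct xs"
  shows "filter (\<lambda>x. x \<in> set (take n xs)) xs = take n xs"
proof -
  have d: "distinct (take n xs @ drop n xs)" using assms by simp
  have "filter (\<lambda>x. x \<in> set (take n xs)) (take n xs @ drop n xs) = take n xs @ []"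
    unfolding filter_append
    using d by (intro arg_cong2[of _ _ _ _ "(@)"]) (auto simp: filter_empty_conv simp del: append_take_drop_id)
  then show ?thesis by simp
qed

lemma distinct_set_drop:
  assumes "distinct xs"
  shows "set (drop n xs) = set xs - set (take n xs)"
proof -
  have "set xs = set (take n xs) \<union> set (drop n xs)" by (metis append_take_drop_id set_append)
  moreover have "set (take n xs) \<inter> set (drop n xs) = {}"
    using assms by (metis append_take_drop_id distinct_append)
  ultimately show ?thesis by blast
qed

lemma acyclic_of_rank:
  fixes f :: "'a \<Rightarrow> nat"
  assumes "\<And>x y. (x, y) \<in> r \<Longrightarrow> f x < f y"
  shows "acyclic r"
proof (rule acyclic_subset)
  show "acyclic (measure f)" by (simp add: wf_acyclic)
qed (use assms in auto)

section \<open>Graphs and admissible partitions\<close>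

lemma from_M_edgeD:
  assumes "from_M \<Gamma>" "(x, y) \<in># edges \<Gamma>"
  shows "x = In \<or> (\<exists>u \<in> internals \<Gamma>. x = Inner u)"
    and "y = Out \<or> (\<exists>v \<in> internals \<Gamma>. y = Inner v)"
  using assms unfolding from_M_def by auto

lemma special_less_nth_iff:
  assumes "distinct (specials \<Gamma>)" "i < length (specials \<Gamma>)" "j < length (specials \<Gamma>)"
  shows "special_less \<Gamma> (specials \<Gamma> ! i) (specials \<Gamma> ! j) \<longleftrightarrow> i < j"
  using assms unfolding special_less_def
  by (metis nth_eq_iff_index_eq order.strict_trans)

text \<open>No edge enters \<open>In\<close> or leaves \<open>Out\<close>, so an edge running the
  wrong way between the two sides must go from an inner vertex of \<open>V2\<close> to one of
  \<open>V1\<close>. Excluding this is the same as closing \<open>V2\<close> under successors, the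
  form in which admissibility is used below.\<close>

lemma admissible_iff:
  assumes "from_M \<Gamma>"
  shows "admissible \<Gamma> (V1, V2) \<longleftrightarrow>
    V1 \<union> V2 = internals \<Gamma> \<and> V1 \<inter> V2 = {} \<and>
    (\<forall>s \<in> V1 \<inter> set (specials \<Gamma>). \<forall>t \<in> V2 \<inter> set (specials \<Gamma>). special_less \<Gamma> t s) \<and>
    (\<forall>u v. (Inner u, Inner v) \<in># edges \<Gamma> \<longrightarrow> u \<in> V2 \<longrightarrow> v \<in> V2)"
    (is "_ \<longleftrightarrow> ?P \<and> ?Q \<and> ?R \<and> ?S")
proof -
  let ?A = "insert In (Inner ` V1)" and ?B = "insert Out (Inner ` V2)"
  have key: "(\<forall>(x, y) \<in># edges \<Gamma>. x \<in> ?A \<and> y \<in> ?B \<or> x \<in> ?B \<and> y \<in> ?A \<longrightarrow> x \<in> ?A \<and> y \<in> ?B) \<longleftrightarrow> ?S"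
    if PQ: ?P ?Q
  proof
    assume L: "\<forall>(x, y) \<in># edges \<Gamma>. x \<in> ?A \<and> y \<in> ?B \<or> x \<in> ?B \<and> y \<in> ?A \<longrightarrow> x \<in> ?A \<and> y \<in> ?B"
    show ?S
    proof (intro allI impI)
      fix u v assume e: "(Inner u, Inner v) \<in># edges \<Gamma>" and "u \<in> V2"
      have "v \<in> V1 \<union> V2" using from_M_edgeD(2)[OF assms e] PQ by auto
      then show "v \<in> V2" using L e \<open>u \<in> V2\<close> PQ(2) by blast
    qed
  next
    assume S: ?S
    show "\<forall>(x, y) \<in># edges \<Gamma>. x \<in> ?A \<and> y \<in> ?B \<or> x \<in> ?B \<and> y \<in> ?A \<longrightarrow> x \<in> ?A \<and> y \<in> ?B"
    proof (intro ballI case_prodI2 impI)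
      fix e x y assume "e \<in># edges \<Gamma>" "e = (x, y)"
        and *: "x \<in> ?A \<and> y \<in> ?B \<or> x \<in> ?B \<and> y \<in> ?A"
      then have e: "(x, y) \<in># edges \<Gamma>" by simp
      show "x \<in> ?A \<and> y \<in> ?B"
        proof (rule ccontr)
        assume "\<not> (x \<in> ?A \<and> y \<in> ?B)"
        then have "x \<in> ?B" "y \<in> ?A" using * by blast+
        then obtain u v where "x = Inner u" "u \<in> V2" "y = Inner v" "v \<in> V1"
          using from_M_edgeD[OF assms e] by auto
        then show False using S e PQ(2) by blast
      qed
    qed
  qed
  show ?thesis
    unfolding admissible_def Let_def fst_conv snd_conv by (intro conj_cong refl key)
qed

lemma admissibleD:
  assumes "from_M \<Gamma>" "admissible \<Gamma> (V1, V2)"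
  shows "V1 \<union> V2 = internals \<Gamma>" and "V1 \<inter> V2 = {}"
    and "\<lbrakk>s \<in> V1; s \<in> set (specials \<Gamma>); t \<in> V2; t \<in> set (specials \<Gamma>)\<rbrakk> \<Longrightarrow> special_less \<Gamma> t s"
    and "\<lbrakk>(Inner u, Inner v) \<in># edges \<Gamma>; u \<in> V2\<rbrakk> \<Longrightarrow> v \<in> V2"
  using assms(2) unfolding admissible_iff[OF assms(1)] by simp_all

section \<open>The second part of an admissible partition\<close>

lemma internals_part2: "internals (part2 \<Gamma> (V1, V2)) = internals \<Gamma> \<inter> V2"
  by (auto simp: internals_def regulars_def part2_def Let_def)

lemma regulars_part2: "regulars (part2 \<Gamma> (V1, V2)) = regulars \<Gamma> \<inter> V2"
  by (auto simp: regulars_def part2_def Let_def)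

lemma specials_part2: "specials (part2 \<Gamma> (V1, V2)) = filter (\<lambda>v. v \<in> V2) (specials \<Gamma>)"
  by (simp add: part2_def Let_def)

text \<open>Since \<open>V2\<close> is closed under successors, a surviving edge never has its head
  in \<open>V1\<close>. The relabelling therefore changes tails only, collapsing those in
  \<open>V1\<close> to the source.\<close>

lemma edges_part2_iff:
  assumes M: "from_M \<Gamma>" and adm: "admissible \<Gamma> (V1, V2)"
  shows "(x, y) \<in># edges (part2 \<Gamma> (V1, V2)) \<longleftrightarrow>
    y \<in> insert Out (Inner ` V2) \<and>
    (x = In \<and> (\<exists>z \<in> insert In (Inner ` V1). (z, y) \<in># edges \<Gamma>) \<or> x \<in> Inner ` V2 \<and> (x, y) \<in># edges \<Gamma>)"
    (is "?L \<longleftrightarrow> ?R")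
proof -
  note a = adm[unfolded admissible_iff[OF M]]
  let ?A = "insert In (Inner ` V1)"
  let ?h = "\<lambda>x. if x \<in> Inner ` V1 then In else x"
  have L: "?L \<longleftrightarrow> (\<exists>x' y'. (x', y') \<in># edges \<Gamma> \<and> \<not> (x' \<in> ?A \<and> y' \<in> ?A) \<and> x = ?h x' \<and> y = ?h y')"
    unfolding part2_def Let_def by (auto simp: image_iff split: prod.splits)
  show ?thesis
  proof
    assume ?L
    then obtain x' y' where e: "(x', y') \<in># edges \<Gamma>" "\<not> (x' \<in> ?A \<and> y' \<in> ?A)" "x = ?h x'" "y = ?h y'"
      using L by blast
    have "y' \<in> insert Out (Inner ` V2)" "y' \<notin> ?A"
      using from_M_edgeD[OF M e(1)] a e(1,2) by blast+
    moreover from this have "y = y'" using e by auto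
    ultimately show ?R
      using from_M_edgeD(1)[OF M e(1)] a e by auto
  next
    assume R: ?R
    then have y: "?h y = y" "y \<notin> ?A" using a by auto
    from R consider z where "z \<in> ?A" "(z, y) \<in># edges \<Gamma>" "x = In"
      | "x \<in> Inner ` V2" "(x, y) \<in># edges \<Gamma>" by blast
    then show ?L
    proof cases
      case 1
      then have "x = ?h z" by auto
      then show ?thesis unfolding L using 1 y by metis
    next
      case 2
      then have "x = ?h x" using a by auto
      then show ?thesis unfolding L using 2 y by metis
    qed
  qed
qed

text \<open>Degrees count parallel edges, which membership of edges does not see, so the filter is
  pulled back through the relabelling on multisets. An edge at \<open>v\<close> is never removed,
  and no other vertex is renamed to \<open>v\<close>.\<close>

lemma in_deg_part2:
  assumes "v \<in> V2" "V1 \<inter> V2 = {}"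
  shows "in_deg (part2 \<Gamma> (V1, V2)) (Inner v) = in_deg \<Gamma> (Inner v)"
proof -
  have "v \<notin> V1" using assms by auto
  then show ?thesis
    unfolding in_deg_def part2_def Let_def
    by (auto simp: filter_mset_image_mset filter_filter_mset intro!: arg_cong[of _ _ size] filter_mset_cong)
qed

lemma out_deg_part2:
  assumes "v \<in> V2" "V1 \<inter> V2 = {}"
  shows "out_deg (part2 \<Gamma> (V1, V2)) (Inner v) = out_deg \<Gamma> (Inner v)"
proof -
  have "v \<notin> V1" using assms by auto
  then show ?thesis
    unfolding out_deg_def part2_def Let_def
    by (auto simp: filter_mset_image_mset filter_filter_mset intro!: arg_cong[of _ _ size] filter_mset_cong)
qed

text \<open>Special vertices of \<open>V1\<close> exceed those of \<open>V2\<close>, so the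
  positions of the latter in the increasing list are downward closed.\<close>

lemma specials_part2_take:
  assumes M: "from_M \<Gamma>" and adm: "admissible \<Gamma> (V1, V2)"
  shows "specials (part2 \<Gamma> (V1, V2)) = take (num_special (part2 \<Gamma> (V1, V2))) (specials \<Gamma>)"
proof -
  have "distinct (specials \<Gamma>)" using M by (simp add: from_M_def)
  note * = special_less_nth_iff[OF this]
  note a = adm[unfolded admissible_iff[OF M]]
  show ?thesis unfolding num_special_def specials_part2
  proof (rule filter_eq_take)
    fix i j assume ij: "i < j" "j < length (specials \<Gamma>)" "specials \<Gamma> ! j \<in> V2"
    show "specials \<Gamma> ! i \<in> V2"
    proof (rule ccontr)
      assume "specials \<Gamma> ! i \<notin> V2"
      then have "specials \<Gamma> ! i \<in> V1" using a ij by (auto simp: internals_def)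
      then have "special_less \<Gamma> (specials \<Gamma> ! j) (specials \<Gamma> ! i)"
        using a ij by auto
      then show False using * ij by auto
    qed
  qed
qed

text \<open>New edges arise only by renaming a tail to \<open>In\<close>, and no edge ends at
  \<open>In\<close>. A path that starts elsewhere thus never uses a new edge. Acyclicity and the
  order condition for \<open>part2\<close> are pulled back along this.\<close>

lemma trancl_part2:
  assumes M: "from_M \<Gamma>" and adm: "admissible \<Gamma> (V1, V2)"
    and "(x, y) \<in> (set_mset (edges (part2 \<Gamma> (V1, V2))))\<^sup>+" and "x \<noteq> In"
  shows "(x, y) \<in> (set_mset (edges \<Gamma>))\<^sup>+ \<and> y \<noteq> In"
  using assms(3,4)
proof (induction rule: trancl.induct)
  case (r_into_trancl a b)
  then show ?case using edges_part2_iff[OF M adm] by blast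
next
  case (trancl_into_trancl a b c)
  then have "(b, c) \<in># edges \<Gamma>" "c \<noteq> In" using edges_part2_iff[OF M adm] by blast+
  with trancl_into_trancl show ?case by (meson trancl.trancl_into_trancl)
qed

lemma from_M_part2:
  assumes M: "from_M \<Gamma>" and adm: "admissible \<Gamma> (V1, V2)"
  shows "from_M (part2 \<Gamma> (V1, V2))"
proof -
  note a = adm[unfolded admissible_iff[OF M]]
  let ?D = "part2 \<Gamma> (V1, V2)"
  note e = edges_part2_iff[OF M adm]
  have int: "internals ?D = V2" using a by (auto simp: internals_part2)
  have dist: "distinct (specials \<Gamma>)" using M by (simp add: from_M_def)
  \<comment> \<open>A cycle cannot pass through \<open>In\<close>, which has no incoming edge, so it
    would already be a cycle of \<Gamma>.\<close>
  have acyc: "acyclic (set_mset (edges ?D))"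
  proof (rule acyclicI, intro allI notI)
    fix x assume x: "(x, x) \<in> (set_mset (edges ?D))\<^sup>+"
    then obtain z where "(z, x) \<in># edges ?D" by (meson tranclD2)
    then have "x \<noteq> In" using e by auto
    with trancl_part2[OF M adm x] M show False by (auto simp: from_M_def acyclic_def)
  qed
  have less: "special_less ?D t s"
    if st: "s \<in> set (specials ?D)" "t \<in> set (specials ?D)"
      "(Inner s, Inner t) \<in> (set_mset (edges ?D))\<^sup>+" for s t
  proof -
    have "(Inner s, Inner t) \<in> (set_mset (edges \<Gamma>))\<^sup>+" using trancl_part2[OF M adm that(3)] by simp
    then have l: "special_less \<Gamma> t s" using that M by (auto simp: from_M_def specials_part2)
    obtain n where n: "specials ?D = take n (specials \<Gamma>)"
      using specials_part2_take[OF M adm] by blast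
    obtain i j where ij: "i < n" "i < length (specials \<Gamma>)" "specials \<Gamma> ! i = t"
        "j < n" "j < length (specials \<Gamma>)" "specials \<Gamma> ! j = s"
      using st(1,2) unfolding n by (auto simp: in_set_conv_nth)
    then have "i < j" using l special_less_nth_iff[OF dist] by blast
    \<comment> \<open>The special vertices left over form a prefix of the old list, so they keep
      their positions.\<close>
    then show ?thesis using ij unfolding special_less_def n by (intro exI[of _ i] exI[of _ j]) auto
  qed
  have deg: "in_deg ?D (Inner v) = in_deg \<Gamma> (Inner v)" "out_deg ?D (Inner v) = out_deg \<Gamma> (Inner v)"
    if "v \<in> V2" for v using in_deg_part2 out_deg_part2 that a by metis+
  have w: "weight \<Gamma> v = Some r \<and> v \<in> V2" if "weight ?D v = Some r" for v r
    using that by (auto simp: part2_def restrict_map_def split: if_splits)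
  show ?thesis
    unfolding from_M_def
  proof (intro conjI)
    show "finite (regulars ?D)" using M by (simp add: from_M_def regulars_part2)
    show "distinct (specials ?D)" using dist by (simp add: specials_part2)
    show "regulars ?D \<inter> set (specials ?D) = {}"
      using M by (auto simp: from_M_def regulars_part2 specials_part2)
    show "\<forall>(x, y)\<in>#edges ?D. x \<in> insert In (Inner ` internals ?D) \<and> y \<in> insert Out (Inner ` internals ?D)"
      unfolding int by (intro ballI case_prodI2) (use e in blast)
    show "\<forall>v\<in>internals ?D. 1 \<le> in_deg ?D (Inner v) \<and> 1 \<le> out_deg ?D (Inner v)"
    proof
      fix v assume "v \<in> internals ?D"
      then have v: "v \<in> internals \<Gamma>" "v \<in> V2" by (auto simp: internals_part2)
      then have "1 \<le> in_deg \<Gamma> (Inner v) \<and> 1 \<le> out_deg \<Gamma> (Inner v)"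
        using M unfolding from_M_def by blast
      then show "1 \<le> in_deg ?D (Inner v) \<and> 1 \<le> out_deg ?D (Inner v)" by (simp add: deg v)
    qed
    show "\<forall>v r. weight ?D v = Some r \<longrightarrow> - 1 \<le> r \<and>
          (r = - 1 \<longrightarrow> 3 \<le> in_deg ?D (Inner v) + out_deg ?D (Inner v))"
    proof (intro allI impI)
      fix v r assume "weight ?D v = Some r"
      then have v: "weight \<Gamma> v = Some r" "v \<in> V2" using w by blast+
      then have "- 1 \<le> r \<and> (r = - 1 \<longrightarrow> 3 \<le> in_deg \<Gamma> (Inner v) + out_deg \<Gamma> (Inner v))"
        using M unfolding from_M_def by blast
      then show "- 1 \<le> r \<and> (r = - 1 \<longrightarrow> 3 \<le> in_deg ?D (Inner v) + out_deg ?D (Inner v))"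
        by (simp add: deg v)
    qed
  qed (use acyc less in blast)+
qed

text \<open>Vertices keep their names when others are merged into the source, so merging in two
  stages and merging at once give literally equal graphs, not merely isomorphic ones. The inclusion
  is what makes the weights and the special vertices agree.\<close>

lemma part2_part2:
  fixes \<Gamma> :: "'a feynman_graph"
  assumes "W2 \<subseteq> V2"
  shows "part2 (part2 \<Gamma> (V1, V2)) (W1, W2) = part2 \<Gamma> (V1 \<union> W1, W2)"
proof -
  have "edges (part2 (part2 \<Gamma> (V1, V2)) (W1, W2)) = edges (part2 \<Gamma> (V1 \<union> W1, W2))"
  proof -
    let ?h = "\<lambda>V x. if x \<in> Inner ` V then In else x"
    let ?out = "\<lambda>V e. \<not> (fst e \<in> insert In (Inner ` V) \<and> snd e \<in> insert In (Inner ` V))"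
    have h: "?h W1 (?h V1 x) = ?h (V1 \<union> W1) x" for x :: "'a vertex" by auto
    have out: "?out V1 e \<and> ?out W1 (map_prod (?h V1) (?h V1) e) \<longleftrightarrow> ?out (V1 \<union> W1) e"
      for e :: "'a vertex \<times> 'a vertex"
      by (cases e) auto
    have "filter_mset (?out W1) (image_mset (map_prod (?h V1) (?h V1)) (filter_mset (?out V1) (edges \<Gamma>)))
      = image_mset (map_prod (?h V1) (?h V1)) (filter_mset (?out (V1 \<union> W1)) (edges \<Gamma>))"
      by (simp only: filter_mset_image_mset filter_filter_mset out)
    moreover have "map_prod (?h W1) (?h W1) (map_prod (?h V1) (?h V1) e)
        = map_prod (?h (V1 \<union> W1)) (?h (V1 \<union> W1)) e" for e :: "'a vertex \<times> 'a vertex"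
      by (simp only: prod.map_comp o_def map_prod_def split_def h fst_conv snd_conv)
    ultimately show ?thesis
      by (simp only: part2_def Let_def fst_conv snd_conv feynman_graph.simps
        image_mset.compositionality o_def)
  qed
  moreover have "weight (part2 (part2 \<Gamma> (V1, V2)) (W1, W2)) = weight (part2 \<Gamma> (V1 \<union> W1, W2))"
    using assms by (simp add: part2_def Let_def Int_absorb1)
  moreover have "specials (part2 (part2 \<Gamma> (V1, V2)) (W1, W2)) = specials (part2 \<Gamma> (V1 \<union> W1, W2))"
    using assms by (auto simp: specials_part2 intro!: filter_cong)
  ultimately show ?thesis by simp
qed

text \<open>The counterpart of \<open>part2_part2\<close> for partitions: a cut of the second part
  is again a cut of \<Gamma>. A special vertex of the enlarged first part is compared through the
  outer partition if it lies in \<open>V1\<close>, and through the inner one otherwise.\<close>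

lemma admissible_part2:
  assumes M: "from_M \<Gamma>" and V: "admissible \<Gamma> (V1, V2)"
    and W: "admissible (part2 \<Gamma> (V1, V2)) (W1, W2)"
  shows "admissible \<Gamma> (V1 \<union> W1, W2)"
proof -
  let ?D = "part2 \<Gamma> (V1, V2)"
  note a = admissibleD[OF M V]
  note b = admissibleD[OF from_M_part2[OF M V] W]
  have b1: "W1 \<union> W2 = V2" using a(1) b(1) by (auto simp: internals_part2)
  obtain n where n: "specials ?D = take n (specials \<Gamma>)"
    using specials_part2_take[OF M V] by blast
  have lift: "special_less \<Gamma> t s" if "special_less ?D t s" for s t
    using that by (auto simp: special_less_def n) metis
  show ?thesis
    unfolding admissible_iff[OF M]
  proof (intro conjI)
    show "V1 \<union> W1 \<union> W2 = internals \<Gamma>" "(V1 \<union> W1) \<inter> W2 = {}"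
      using a(1,2) b(2) b1 by blast+
    show "\<forall>u v. (Inner u, Inner v) \<in># edges \<Gamma> \<longrightarrow> u \<in> W2 \<longrightarrow> v \<in> W2"
    proof (intro allI impI)
      fix u v assume uv: "(Inner u, Inner v) \<in># edges \<Gamma>" "u \<in> W2"
      \<comment> \<open>Closure of \<open>V2\<close> puts both ends into the second part, so the
        edge survives there and the closure of \<open>W2\<close> applies.\<close>
      then have "u \<in> V2" using b1 by blast
      moreover from this have "v \<in> V2" using a(4) uv(1) by blast
      ultimately have "(Inner u, Inner v) \<in># edges ?D"
        using uv(1) by (simp add: edges_part2_iff[OF M V])
      then show "v \<in> W2" using b(4) uv(2) by blast
    qed
    show "\<forall>s\<in>(V1 \<union> W1) \<inter> set (specials \<Gamma>). \<forall>t\<in>W2 \<inter> set (specials \<Gamma>). special_less \<Gamma> t s"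
    proof (intro ballI)
      fix s t assume s: "s \<in> (V1 \<union> W1) \<inter> set (specials \<Gamma>)" and t: "t \<in> W2 \<inter> set (specials \<Gamma>)"
      have t2: "t \<in> V2" using t b1 by blast
      show "special_less \<Gamma> t s"
      proof (cases "s \<in> V1")
        case True
        show ?thesis by (rule a(3)) (use True s t t2 in auto)
      next
        case False
        then have "s \<in> W1" "s \<in> V2" using s b1 by blast+
        then have "special_less ?D t s"
          using s t t2 by (intro b(3)) (simp_all add: specials_part2)
        then show ?thesis by (rule lift)
      qed
    qed
  qed
qed

section \<open>The first part of an admissible partition, and when it lies in N\<close>

lemma edges_part1_iff:
  assumes M: "from_M \<Gamma>" and adm: "admissible \<Gamma> (V1, V2)"
  shows "(x, y) \<in># edges (part1 \<Gamma> (V1, V2)) \<longleftrightarrow>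
    x \<in> insert In (Inner ` V1) \<and>
    (y = Out \<and> (\<exists>z \<in> insert Out (Inner ` V2). (x, z) \<in># edges \<Gamma>) \<or> y \<in> Inner ` V1 \<and> (x, y) \<in># edges \<Gamma>)"
    (is "?L \<longleftrightarrow> ?R")
proof -
  note a = admissibleD[OF M adm]
  let ?B = "insert Out (Inner ` V2)"
  let ?h = "\<lambda>x. if x \<in> Inner ` V2 then Out else x"
  have L: "?L \<longleftrightarrow> (\<exists>x' y'. (x', y') \<in># edges \<Gamma> \<and> \<not> (x' \<in> ?B \<and> y' \<in> ?B) \<and> x = ?h x' \<and> y = ?h y')"
    unfolding part1_def Let_def by (auto simp: image_iff split: prod.splits)
  show ?thesis
  proof
    assume ?L
    then obtain x' y' where e: "(x', y') \<in># edges \<Gamma>" "\<not> (x' \<in> ?B \<and> y' \<in> ?B)" "x = ?h x'" "y = ?h y'"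
      using L by blast
    \<comment> \<open>Dually to the second part, only heads are relabelled: a tail in
      \<open>V2\<close> would force the head into \<open>?B\<close>, and such edges have been
      removed.\<close>
    have x': "x' \<notin> ?B"
    proof
      assume "x' \<in> ?B"
      with from_M_edgeD(1)[OF M e(1)] obtain u where "x' = Inner u" "u \<in> V2" by auto
      with from_M_edgeD(2)[OF M e(1)] a(4)[of u] e(1) have "y' \<in> ?B" by auto
      with \<open>x' \<in> ?B\<close> e(2) show False by blast
    qed
    then have "x = x'" "x \<in> insert In (Inner ` V1)"
      using from_M_edgeD(1)[OF M e(1)] a(1) e(3) by auto
    then show ?R
      using from_M_edgeD(2)[OF M e(1)] a(1) e by auto
  next
    assume R: ?R
    then have x: "?h x = x" "x \<notin> ?B" using a(2) by auto
    from R consider z where "z \<in> ?B" "(x, z) \<in># edges \<Gamma>" "y = Out"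
      | "y \<in> Inner ` V1" "(x, y) \<in># edges \<Gamma>" by blast
    then show ?L
    proof cases
      case 1
      then have "y = ?h z" by auto
      then show ?thesis unfolding L using 1 x by metis
    next
      case 2
      then have "y = ?h y" using a(2) by auto
      then show ?thesis unfolding L using 2 x by metis
    qed
  qed
qed

lemma in_deg_part1:
  assumes "v \<in> V1" "V1 \<inter> V2 = {}"
  shows "in_deg (part1 \<Gamma> (V1, V2)) (Inner v) = in_deg \<Gamma> (Inner v)"
proof -
  have "v \<notin> V2" using assms by auto
  then show ?thesis
    unfolding in_deg_def part1_def Let_def
    by (auto simp: filter_mset_image_mset filter_filter_mset intro!: arg_cong[of _ _ size] filter_mset_cong)
qed

lemma out_deg_part1:
  assumes "v \<in> V1" "V1 \<inter> V2 = {}"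
  shows "out_deg (part1 \<Gamma> (V1, V2)) (Inner v) = out_deg \<Gamma> (Inner v)"
proof -
  have "v \<notin> V2" using assms by auto
  then show ?thesis
    unfolding out_deg_def part1_def Let_def
    by (auto simp: filter_mset_image_mset filter_filter_mset intro!: arg_cong[of _ _ size] filter_mset_cong)
qed

lemma internals_part1: "internals (part1 \<Gamma> (V1, V2)) = internals \<Gamma> \<inter> V1"
  by (auto simp: internals_def regulars_def part1_def Let_def)

text \<open>If all of \<open>V1\<close> is frontal, every edge of the first part starts at
  \<open>In\<close> or ends at \<open>Out\<close>. This makes acyclicity and the order condition
  immediate, and it is the only case that the inversion equation calls for.\<close>

lemma from_M_part1_frontal:
  assumes M: "from_M \<Gamma>" and adm: "admissible \<Gamma> (V1, V2)"
    and fr: "\<And>v. v \<in> V1 \<Longrightarrow> frontal \<Gamma> v"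
  shows "from_M (part1 \<Gamma> (V1, V2))"
proof -
  note a = admissibleD[OF M adm]
  let ?D = "part1 \<Gamma> (V1, V2)"
  have int: "internals ?D = V1" using a(1) by (auto simp: internals_part1)
  have e: "x \<in> insert In (Inner ` V1) \<and> y \<in> insert Out (Inner ` V1) \<and> (x = In \<or> y = Out)"
    if "(x, y) \<in># edges ?D" for x y
    using that fr unfolding edges_part1_iff[OF M adm] frontal_def by blast
  \<comment> \<open>The ranks 0, 1, 2 of \<open>In\<close>, inner vertices and \<open>Out\<close>
    increase along each edge.\<close>
  have acyc: "acyclic (set_mset (edges ?D))"
    by (rule acyclic_of_rank[where f = "case_vertex 0 2 (\<lambda>_. 1)"]) (drule e, auto)
  \<comment> \<open>The first edge of such a path would end at \<open>Out\<close>, which no edge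
    leaves.\<close>
  have no_path: "(Inner s, Inner t) \<notin> (set_mset (edges ?D))\<^sup>+" for s t
  proof
    assume "(Inner s, Inner t) \<in> (set_mset (edges ?D))\<^sup>+"
    then obtain y where y: "(Inner s, y) \<in># edges ?D" "(y, Inner t) \<in> (set_mset (edges ?D))\<^sup>*"
      by (meson tranclD)
    then have "y = Out" using e by blast
    with y(2) obtain z where "(Out, z) \<in># edges ?D" by (metis converse_rtranclE vertex.distinct(5))
    then show False using e by blast
  qed
  have deg: "in_deg ?D (Inner v) = in_deg \<Gamma> (Inner v)" "out_deg ?D (Inner v) = out_deg \<Gamma> (Inner v)"
    if "v \<in> V1" for v using in_deg_part1 out_deg_part1 that a(2) by metis+
  have w: "weight \<Gamma> v = Some r \<and> v \<in> V1" if "weight ?D v = Some r" for v r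
    using that by (auto simp: part1_def restrict_map_def split: if_splits)
  show ?thesis
    unfolding from_M_def
  proof (intro conjI)
    show "finite (regulars ?D)" "distinct (specials ?D)" "regulars ?D \<inter> set (specials ?D) = {}"
      using M by (auto simp: from_M_def regulars_def part1_def Let_def)
    show "\<forall>(x, y)\<in>#edges ?D. x \<in> insert In (Inner ` internals ?D) \<and> y \<in> insert Out (Inner ` internals ?D)"
      unfolding int by (intro ballI case_prodI2) (use e in blast)
    show "\<forall>v\<in>internals ?D. 1 \<le> in_deg ?D (Inner v) \<and> 1 \<le> out_deg ?D (Inner v)"
    proof
      fix v assume "v \<in> internals ?D"
      then have v: "v \<in> internals \<Gamma>" "v \<in> V1" by (auto simp: internals_part1)
      then have "1 \<le> in_deg \<Gamma> (Inner v) \<and> 1 \<le> out_deg \<Gamma> (Inner v)"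
        using M unfolding from_M_def by blast
      then show "1 \<le> in_deg ?D (Inner v) \<and> 1 \<le> out_deg ?D (Inner v)" by (simp add: deg v)
    qed
    show "\<forall>v r. weight ?D v = Some r \<longrightarrow> - 1 \<le> r \<and>
          (r = - 1 \<longrightarrow> 3 \<le> in_deg ?D (Inner v) + out_deg ?D (Inner v))"
    proof (intro allI impI)
      fix v r assume "weight ?D v = Some r"
      then have v: "weight \<Gamma> v = Some r" "v \<in> V1" using w by blast+
      then have "- 1 \<le> r \<and> (r = - 1 \<longrightarrow> 3 \<le> in_deg \<Gamma> (Inner v) + out_deg \<Gamma> (Inner v))"
        using M unfolding from_M_def by blast
      then show "- 1 \<le> r \<and> (r = - 1 \<longrightarrow> 3 \<le> in_deg ?D (Inner v) + out_deg ?D (Inner v))"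
        by (simp add: deg v)
    qed
  qed (use acyc no_path in blast)+
qed

text \<open>This turns the summation condition of the inversion equation into one on \<Gamma>
  itself. If an edge into \<open>v\<close> from \<open>V1\<close> had an inner tail, that tail would
  lie in \<open>V1\<close>, giving an internal edge of the first part, or in \<open>V2\<close>,
  against closure under successors.\<close>

lemma from_N_part1_iff:
  assumes M: "from_M \<Gamma>" and adm: "admissible \<Gamma> (V1, V2)"
  shows "from_N (part1 \<Gamma> (V1, V2)) \<longleftrightarrow> (\<forall>v \<in> V1. frontal \<Gamma> v)"
proof
  note a = admissibleD[OF M adm]
  assume N: "from_N (part1 \<Gamma> (V1, V2))"
  show "\<forall>v \<in> V1. frontal \<Gamma> v"
  proof
    fix v assume v: "v \<in> V1"
    have "x = In" if x: "(x, Inner v) \<in># edges \<Gamma>" for x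
    proof (rule ccontr)
      assume "x \<noteq> In"
      then obtain u where u: "x = Inner u" "u \<in> internals \<Gamma>" using from_M_edgeD(1)[OF M x] by blast
      show False
      proof (cases "u \<in> V1")
        case True
        then have "(Inner u, Inner v) \<in># edges (part1 \<Gamma> (V1, V2))"
          using x u v by (simp add: edges_part1_iff[OF M adm])
        then show False using N by (simp add: from_N_def)
      next
        case False
        then show False using a(1,2) a(4)[of u v] u x v by blast
      qed
    qed
    then show "frontal \<Gamma> v" using v a(1) by (auto simp: frontal_def)
  qed
next
  assume fr: "\<forall>v \<in> V1. frontal \<Gamma> v"
  have "(Inner u, Inner v) \<notin># edges (part1 \<Gamma> (V1, V2))" for u v
    using fr unfolding edges_part1_iff[OF M adm] frontal_def by blast
  then show "from_N (part1 \<Gamma> (V1, V2))"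
    using from_M_part1_frontal[OF M adm] fr by (simp add: from_N_def)
qed

section \<open>The partitions without regular frontal vertices\<close>

definition no_frontal_regular :: "'v feynman_graph \<Rightarrow> bool" where
  "no_frontal_regular \<Gamma> \<longleftrightarrow> (\<forall>v \<in> regulars \<Gamma>. \<not> frontal \<Gamma> v)"

text \<open>The candidate for the second side of \<open>sigma \<Gamma> i\<close>. The reflexive
  closure puts s_1, ..., s_i themselves into it; that no further special vertex gets in is shown in
  \<open>reach_specials\<close>.\<close>

definition reach :: "'v feynman_graph \<Rightarrow> nat \<Rightarrow> 'v set" where
  "reach \<Gamma> i = {v \<in> internals \<Gamma>. \<exists>s \<in> set (take i (specials \<Gamma>)).
     (Inner s, Inner v) \<in> (set_mset (edges \<Gamma>))\<^sup>*}"

text \<open>Paths between special vertices go downwards in the order, so from the first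
  \<open>i\<close> of them only earlier ones can be reached.\<close>

lemma reach_specials:
  assumes M: "from_M \<Gamma>"
  shows "reach \<Gamma> i \<inter> set (specials \<Gamma>) = set (take i (specials \<Gamma>))"
proof (intro equalityI subsetI)
  fix t assume "t \<in> set (take i (specials \<Gamma>))"
  then show "t \<in> reach \<Gamma> i \<inter> set (specials \<Gamma>)"
    by (auto simp: reach_def internals_def dest: in_set_takeD)
next
  fix t assume "t \<in> reach \<Gamma> i \<inter> set (specials \<Gamma>)"
  then obtain s where s: "s \<in> set (take i (specials \<Gamma>))" "t \<in> set (specials \<Gamma>)"
    "(Inner s, Inner t) \<in> (set_mset (edges \<Gamma>))\<^sup>*" by (auto simp: reach_def)
  show "t \<in> set (take i (specials \<Gamma>))"
  proof (cases "s = t")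
    case False
    then have "(Inner s, Inner t) \<in> (set_mset (edges \<Gamma>))\<^sup>+" using s(3) by (simp add: rtrancl_eq_or_trancl)
    then have l: "special_less \<Gamma> t s" using M s by (auto simp: from_M_def dest: in_set_takeD)
    obtain q where q: "q < length (specials \<Gamma>)" "q < i" "specials \<Gamma> ! q = s"
      using s(1) by (auto simp: in_set_conv_nth)
    obtain p where p: "p < length (specials \<Gamma>)" "specials \<Gamma> ! p = t"
      using s(2) by (auto simp: in_set_conv_nth)
    have "p < q" using l p q special_less_nth_iff M by (metis from_M_def)
    then show ?thesis using p q by (auto simp: in_set_conv_nth intro!: exI[of _ p])
  qed (use s in simp)
qed

lemma admissible_reach:
  assumes M: "from_M \<Gamma>"
  shows "admissible \<Gamma> (internals \<Gamma> - reach \<Gamma> i, reach \<Gamma> i)"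
  unfolding admissible_iff[OF M]
proof (intro conjI)
  show "internals \<Gamma> - reach \<Gamma> i \<union> reach \<Gamma> i = internals \<Gamma>" by (auto simp: reach_def)
  show "(internals \<Gamma> - reach \<Gamma> i) \<inter> reach \<Gamma> i = {}" by auto
  show "\<forall>u v. (Inner u, Inner v) \<in># edges \<Gamma> \<longrightarrow> u \<in> reach \<Gamma> i \<longrightarrow> v \<in> reach \<Gamma> i"
  proof (intro allI impI)
    fix u v assume e: "(Inner u, Inner v) \<in># edges \<Gamma>" "u \<in> reach \<Gamma> i"
    have "v \<in> internals \<Gamma>" using from_M_edgeD(2)[OF M e(1)] by auto
    then show "v \<in> reach \<Gamma> i" using e by (auto simp: reach_def intro: rtrancl_into_rtrancl)
  qed
  show "\<forall>s\<in>(internals \<Gamma> - reach \<Gamma> i) \<inter> set (specials \<Gamma>).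
       \<forall>t\<in>reach \<Gamma> i \<inter> set (specials \<Gamma>). special_less \<Gamma> t s"
  proof (intro ballI)
    fix s t assume s: "s \<in> (internals \<Gamma> - reach \<Gamma> i) \<inter> set (specials \<Gamma>)"
      and t: "t \<in> reach \<Gamma> i \<inter> set (specials \<Gamma>)"
    obtain p where p: "p < length (specials \<Gamma>)" "p < i" "specials \<Gamma> ! p = t"
      using t unfolding reach_specials[OF M] by (auto simp: in_set_conv_nth)
    obtain q where q: "q < length (specials \<Gamma>)" "specials \<Gamma> ! q = s"
      using s by (auto simp: in_set_conv_nth)
    have "s \<notin> set (take i (specials \<Gamma>))" using s reach_specials[OF M] by blast
    then have "\<not> q < i" using q by (auto simp: in_set_conv_nth)
    then show "special_less \<Gamma> t s" using p q unfolding special_less_def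
      by (intro exI[of _ p] exI[of _ q]) auto
  qed
qed

lemma specials_part2_reach:
  assumes M: "from_M \<Gamma>"
  shows "specials (part2 \<Gamma> (V, reach \<Gamma> i)) = take i (specials \<Gamma>)"
proof -
  have "specials (part2 \<Gamma> (V, reach \<Gamma> i)) = filter (\<lambda>v. v \<in> set (take i (specials \<Gamma>))) (specials \<Gamma>)"
    unfolding specials_part2 reach_specials[OF M, symmetric] by (auto intro: filter_cong)
  then show ?thesis using filter_mem_take M by (metis from_M_def)
qed

text \<open>A regular vertex differs from the special vertex it is reached from, so the path has a
  last edge. The tail of that edge is reachable as well, and the edge survives in the second part,
  contradicting frontality.\<close>

lemma no_frontal_regular_reach:
  assumes M: "from_M \<Gamma>"
  shows "no_frontal_regular (part2 \<Gamma> (internals \<Gamma> - reach \<Gamma> i, reach \<Gamma> i))"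
  unfolding no_frontal_regular_def
proof (intro ballI notI)
  let ?D = "part2 \<Gamma> (internals \<Gamma> - reach \<Gamma> i, reach \<Gamma> i)"
  fix v assume v: "v \<in> regulars ?D" and f: "frontal ?D v"
  then have vr: "v \<in> regulars \<Gamma>" "v \<in> reach \<Gamma> i" by (auto simp: regulars_part2)
  then obtain s where s: "s \<in> set (take i (specials \<Gamma>))" "(Inner s, Inner v) \<in> (set_mset (edges \<Gamma>))\<^sup>*"
    by (auto simp: reach_def)
  then have "s \<noteq> v" using vr M by (auto simp: from_M_def dest: in_set_takeD)
  then obtain x where x: "(Inner s, x) \<in> (set_mset (edges \<Gamma>))\<^sup>*" "(x, Inner v) \<in># edges \<Gamma>"
    using s(2) by (metis rtranclE vertex.inject)
  have "x \<noteq> In"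
  proof
    assume "x = In"
    then obtain z where "(z, In) \<in># edges \<Gamma>" using x(1) by (metis rtranclE vertex.distinct(3))
    then show False using from_M_edgeD(2)[OF M] by blast
  qed
  then obtain u where u: "x = Inner u" "u \<in> internals \<Gamma>" using from_M_edgeD(1)[OF M x(2)] by blast
  then have "u \<in> reach \<Gamma> i" using x s by (auto simp: reach_def)
  then have "(Inner u, Inner v) \<in># edges ?D"
    using edges_part2_iff[OF M admissible_reach[OF M]] u x vr by blast
  then show False using f by (auto simp: frontal_def)
qed

text \<open>The special vertices of \<open>V2\<close> must be the first \<open>i\<close>, and
  closure under successors gives one inclusion. Conversely, a regular vertex of \<open>V2\<close> is
  not frontal in the second part, hence has a predecessor in \<open>V2\<close>; going backwards must
  stop at a special vertex.\<close>

lemma no_frontal_regular_unique: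
  assumes M: "from_M \<Gamma>" and adm: "admissible \<Gamma> (V1, V2)"
    and nf: "no_frontal_regular (part2 \<Gamma> (V1, V2))"
    and i: "num_special (part2 \<Gamma> (V1, V2)) = i"
  shows "(V1, V2) = (internals \<Gamma> - reach \<Gamma> i, reach \<Gamma> i)"
proof -
  note a = adm[unfolded admissible_iff[OF M]]
  let ?E = "set_mset (edges \<Gamma>)"
  have sp: "V2 \<inter> set (specials \<Gamma>) = set (take i (specials \<Gamma>))"
    using specials_part2_take[OF M adm] i by (metis specials_part2 Int_commute inter_set_filter Int_def Collect_mem_eq)
  have up: "y \<in> insert Out (Inner ` V2)" if "(Inner s, y) \<in> ?E\<^sup>*" "s \<in> V2" for s y
    using that
  proof (induction rule: rtrancl_induct)
    case (step y z)
    then show ?case using from_M_edgeD[OF M, of y z] a by blast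
  qed simp
  have "reach \<Gamma> i \<subseteq> V2"
    using up sp by (fastforce simp: reach_def)
  moreover have "V2 \<subseteq> reach \<Gamma> i"
  proof
    \<comment> \<open>A finite acyclic edge relation permits induction over predecessors.\<close>
    have "finite ?E" "acyclic ?E" using M by (auto simp: from_M_def)
    then have wf: "wf ?E" by (rule finite_acyclic_wf)
    have "x = Inner v \<longrightarrow> v \<in> V2 \<longrightarrow> v \<in> reach \<Gamma> i" for x v
    proof (induction x arbitrary: v rule: wf_induct_rule[OF wf])
      case (1 x)
      show ?case
      proof (intro impI)
        assume x: "x = Inner v" and v: "v \<in> V2"
        show "v \<in> reach \<Gamma> i"
        proof (cases "v \<in> set (specials \<Gamma>)")
          case True
          then show ?thesis using v sp reach_specials[OF M] by blast
        next
          case False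
          then have "v \<in> regulars (part2 \<Gamma> (V1, V2))"
            using v a by (auto simp: regulars_part2 internals_def)
          then have "\<not> frontal (part2 \<Gamma> (V1, V2)) v" "v \<in> internals (part2 \<Gamma> (V1, V2))"
            using nf by (auto simp: no_frontal_regular_def internals_def)
          then obtain z where "z \<noteq> In" "(z, Inner v) \<in># edges (part2 \<Gamma> (V1, V2))"
            by (auto simp: frontal_def)
          then obtain u where u: "u \<in> V2" "(Inner u, Inner v) \<in># edges \<Gamma>"
            using edges_part2_iff[OF M adm] by blast
          then have "u \<in> reach \<Gamma> i" using 1 x by blast
          then show ?thesis
            using admissible_reach[OF M, of i, unfolded admissible_iff[OF M]] u by blast
        qed
      qed
    qed
    then show "v \<in> reach \<Gamma> i" if "v \<in> V2" for v using that by blast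
  qed
  ultimately show ?thesis using a by auto
qed

lemma sigma_eq:
  assumes M: "from_M \<Gamma>" and i: "i \<le> num_special \<Gamma>"
  shows "sigma \<Gamma> i = (internals \<Gamma> - reach \<Gamma> i, reach \<Gamma> i)"
  unfolding sigma_def
proof (rule the_equality)
  show "admissible \<Gamma> (internals \<Gamma> - reach \<Gamma> i, reach \<Gamma> i) \<and>
    num_special (part2 \<Gamma> (internals \<Gamma> - reach \<Gamma> i, reach \<Gamma> i)) = i \<and>
    (\<forall>v\<in>regulars (part2 \<Gamma> (internals \<Gamma> - reach \<Gamma> i, reach \<Gamma> i)).
        \<not> frontal (part2 \<Gamma> (internals \<Gamma> - reach \<Gamma> i, reach \<Gamma> i)) v)"
    using admissible_reach[OF M] no_frontal_regular_reach[OF M] specials_part2_reach[OF M] i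
    by (auto simp: no_frontal_regular_def num_special_def)
next
  fix \<pi> assume "admissible \<Gamma> \<pi> \<and> num_special (part2 \<Gamma> \<pi>) = i \<and>
    (\<forall>v\<in>regulars (part2 \<Gamma> \<pi>). \<not> frontal (part2 \<Gamma> \<pi>) v)"
  then show "\<pi> = (internals \<Gamma> - reach \<Gamma> i, reach \<Gamma> i)"
    using no_frontal_regular_unique[OF M] by (cases \<pi>) (auto simp: no_frontal_regular_def)
qed

section \<open>Tail graphs and their compatibility with second parts\<close>

lemma tail_graph_eq:
  assumes "from_M \<Gamma>" "i \<le> num_special \<Gamma>"
  shows "tail_graph \<Gamma> i = part2 \<Gamma> (internals \<Gamma> - reach \<Gamma> i, reach \<Gamma> i)"
  by (simp add: tail_graph_def sigma_eq[OF assms])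

lemma
  assumes "from_M \<Gamma>" "i \<le> num_special \<Gamma>"
  shows from_M_tail_graph: "from_M (tail_graph \<Gamma> i)"
    and specials_tail_graph: "specials (tail_graph \<Gamma> i) = take i (specials \<Gamma>)"
    and no_frontal_regular_tail_graph: "no_frontal_regular (tail_graph \<Gamma> i)"
  using assms
  by (simp_all add: tail_graph_eq from_M_part2 admissible_reach specials_part2_reach no_frontal_regular_reach)

lemma regulars_tail_graph:
  assumes "from_M \<Gamma>" "i \<le> num_special \<Gamma>"
  shows "regulars (tail_graph \<Gamma> i) \<subseteq> regulars \<Gamma>"
  using assms by (auto simp: tail_graph_eq regulars_part2)

lemma num_special_tail_graph:
  assumes "from_M \<Gamma>" "i \<le> num_special \<Gamma>"
  shows "num_special (tail_graph \<Gamma> i) = i"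
  using assms by (simp add: num_special_def specials_tail_graph)

text \<open>Seen from \<Gamma>, the tail graph of a second part is itself the second part of an
  admissible partition, with \<open>i\<close> special vertices and no frontal regular ones.
  Uniqueness identifies that partition with \<open>sigma \<Gamma> i\<close>.\<close>

lemma tail_graph_part2:
  assumes M: "from_M \<Gamma>" and adm: "admissible \<Gamma> (V1, V2)"
    and i: "i \<le> num_special (part2 \<Gamma> (V1, V2))"
  shows "tail_graph (part2 \<Gamma> (V1, V2)) i = tail_graph \<Gamma> i"
proof -
  let ?D = "part2 \<Gamma> (V1, V2)"
  let ?W1 = "internals ?D - reach ?D i" and ?W2 = "reach ?D i"
  note MD = from_M_part2[OF M adm]
  have sub: "?W2 \<subseteq> V2" by (auto simp: reach_def internals_part2)
  have eq: "tail_graph ?D i = part2 \<Gamma> (V1 \<union> ?W1, ?W2)"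
    unfolding tail_graph_eq[OF MD i] by (rule part2_part2[OF sub])
  have "(V1 \<union> ?W1, ?W2) = (internals \<Gamma> - reach \<Gamma> i, reach \<Gamma> i)"
    using no_frontal_regular_unique[OF M admissible_part2[OF M adm admissible_reach[OF MD]]]
      no_frontal_regular_tail_graph[OF MD i] num_special_tail_graph[OF MD i]
    unfolding eq by blast
  moreover have "i \<le> num_special \<Gamma>"
    using i unfolding num_special_def specials_part2 by (meson length_filter_le order_trans)
  ultimately show ?thesis unfolding eq by (simp only: tail_graph_eq[OF M])
qed

lemma tail_graph_tail_graph:
  assumes "from_M \<Gamma>" "i \<le> j" "j \<le> num_special \<Gamma>"
  shows "tail_graph (tail_graph \<Gamma> j) i = tail_graph \<Gamma> i"
  using assms tail_graph_part2[OF assms(1) admissible_reach[OF assms(1)], of i j]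
    num_special_tail_graph[OF assms(1), of j]
  by (simp add: tail_graph_eq[of \<Gamma> j])

section \<open>The recursion along the special vertices\<close>

text \<open>Special vertices are listed increasingly, so the \<open>j\<close> largest are the last
  \<open>j\<close> entries. For \<open>j\<close> beyond their number the truncated subtraction
  repeats the last partition, hence the bounds on \<open>j\<close> in some of the lemmas.\<close>

context
  fixes \<Gamma> :: "'v feynman_graph" and P :: "nat \<Rightarrow> 'v set \<times> 'v set"
  assumes M: "from_M \<Gamma>"
  defines "P j \<equiv> (set (drop (num_special \<Gamma> - j) (specials \<Gamma>)),
    internals \<Gamma> - set (drop (num_special \<Gamma> - j) (specials \<Gamma>)))"
begin

lemma distinct_specials: "distinct (specials \<Gamma>)"
  using M by (simp add: from_M_def)

lemma specials_part2_top:
  "specials (part2 \<Gamma> (P j)) = take (num_special \<Gamma> - j) (specials \<Gamma>)"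
proof -
  have "specials (part2 \<Gamma> (P j)) =
      filter (\<lambda>v. v \<in> set (take (num_special \<Gamma> - j) (specials \<Gamma>))) (specials \<Gamma>)"
    unfolding P_def specials_part2 distinct_set_drop[OF distinct_specials]
    by (rule filter_cong) (auto simp: internals_def)
  then show ?thesis by (simp add: filter_mem_take[OF distinct_specials])
qed

lemma num_special_part2_top: "num_special (part2 \<Gamma> (P j)) = num_special \<Gamma> - j"
  unfolding num_special_def[of "part2 _ _"] specials_part2_top by (simp add: num_special_def)

lemma num_special_part1_top:
  assumes "j \<le> num_special \<Gamma>"
  shows "num_special (part1 \<Gamma> (P j)) = j"
proof -
  have "specials (part1 \<Gamma> (P j)) = filter (\<lambda>v. v \<in> set (drop (num_special \<Gamma> - j) (specials \<Gamma>))) (specials \<Gamma>)"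
    by (simp add: P_def part1_def Let_def)
  moreover have "specials (part2 \<Gamma> (P j)) =
      filter (\<lambda>v. v \<notin> set (drop (num_special \<Gamma> - j) (specials \<Gamma>))) (specials \<Gamma>)"
    unfolding P_def specials_part2 by (rule filter_cong) (auto simp: internals_def)
  \<comment> \<open>The two lists are complementary filters of one list, so their lengths add
    up.\<close>
  ultimately have "num_special (part1 \<Gamma> (P j)) + num_special (part2 \<Gamma> (P j)) = num_special \<Gamma>"
    by (simp add: num_special_def sum_length_filter_compl)
  then show ?thesis using assms num_special_part2_top[of j] by simp
qed

lemma regulars_part2_top: "regulars (part2 \<Gamma> (P j)) = regulars \<Gamma>"
  using M unfolding P_def regulars_part2
  by (auto simp: from_M_def internals_def dest!: in_set_dropD)

lemma inj_on_top: "inj_on P {..num_special \<Gamma>}"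
  by (rule inj_on_inverseI[where g = "\<lambda>\<pi>. num_special (part1 \<Gamma> \<pi>)"]) (simp add: num_special_part1_top)

text \<open>Frontal vertices receive no edge from inner vertices, so removing them leaves a set
  closed under successors.\<close>

lemma admissible_top:
  assumes fr: "\<And>v. v \<in> set (drop (num_special \<Gamma> - j) (specials \<Gamma>)) \<Longrightarrow> frontal \<Gamma> v"
  shows "admissible \<Gamma> (P j)"
  unfolding P_def admissible_iff[OF M]
proof (intro conjI ballI allI impI)
  let ?n = "num_special \<Gamma> - j"
  show "set (drop ?n (specials \<Gamma>)) \<union> (internals \<Gamma> - set (drop ?n (specials \<Gamma>))) = internals \<Gamma>"
    by (auto simp: internals_def dest: in_set_dropD)
  show "set (drop ?n (specials \<Gamma>)) \<inter> (internals \<Gamma> - set (drop ?n (specials \<Gamma>))) = {}"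
    by auto
  {
    fix u v assume uv: "(Inner u, Inner v) \<in># edges \<Gamma>"
      and "u \<in> internals \<Gamma> - set (drop ?n (specials \<Gamma>))"
    have "v \<notin> set (drop ?n (specials \<Gamma>))" using uv fr by (auto simp: frontal_def)
    moreover have "v \<in> internals \<Gamma>" using from_M_edgeD(2)[OF M uv] by auto
    ultimately show "v \<in> internals \<Gamma> - set (drop ?n (specials \<Gamma>))" by simp
  }
  fix s t
  assume s: "s \<in> set (drop ?n (specials \<Gamma>)) \<inter> set (specials \<Gamma>)"
    and t: "t \<in> (internals \<Gamma> - set (drop ?n (specials \<Gamma>))) \<inter> set (specials \<Gamma>)"
  then have "t \<in> set (take ?n (specials \<Gamma>))" by (auto simp: distinct_set_drop[OF distinct_specials])
  then obtain p where p: "p < ?n" "p < length (specials \<Gamma>)" "specials \<Gamma> ! p = t"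
    by (auto simp: in_set_conv_nth)
  obtain q where q: "q < length (specials \<Gamma>) - ?n" "specials \<Gamma> ! (?n + q) = s"
    using s by (auto simp: in_set_conv_nth num_special_def)
  show "special_less \<Gamma> t s"
    unfolding special_less_def using p q by (intro exI[of _ p] exI[of _ "?n + q"]) auto
qed

text \<open>Membership in N makes \<open>V1\<close> frontal, and the absence of frontal regular
  vertices leaves only special ones there. As the special vertices of \<open>V2\<close> form an
  initial segment, \<open>V1\<close> is the remaining final segment.\<close>

lemma admissible_from_N_eq_top:
  assumes nf: "no_frontal_regular \<Gamma>"
  shows "{\<pi>. admissible \<Gamma> \<pi> \<and> from_N (part1 \<Gamma> \<pi>)} =
    P ` {j. j \<le> num_special \<Gamma> \<and> (\<forall>v \<in> set (drop (num_special \<Gamma> - j) (specials \<Gamma>)). frontal \<Gamma> v)}"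
    (is "?L = P ` ?J")
proof (intro equalityI subsetI)
  fix \<pi> assume "\<pi> \<in> P ` ?J"
  then obtain j where j: "\<pi> = P j" "j \<in> ?J" by blast
  then have "admissible \<Gamma> (P j)" by (intro admissible_top) auto
  moreover from this have "from_N (part1 \<Gamma> (P j))"
    using j(2) from_N_part1_iff[OF M] unfolding P_def by blast
  ultimately show "\<pi> \<in> ?L" using j(1) by simp
next
  fix \<pi> assume "\<pi> \<in> ?L"
  moreover obtain V1 V2 where \<pi>: "\<pi> = (V1, V2)" by fastforce
  ultimately have adm: "admissible \<Gamma> (V1, V2)" and "from_N (part1 \<Gamma> (V1, V2))" by auto
  then have fr: "\<forall>v \<in> V1. frontal \<Gamma> v" using from_N_part1_iff[OF M adm] by simp
  note a = admissibleD[OF M adm]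
  have V1: "V1 \<subseteq> set (specials \<Gamma>)"
    using fr nf a(1) by (auto simp: no_frontal_regular_def internals_def)
  define m where "m = num_special (part2 \<Gamma> (V1, V2))"
  have m: "m \<le> num_special \<Gamma>"
    unfolding m_def num_special_def specials_part2 by (rule length_filter_le)
  have sp: "filter (\<lambda>v. v \<in> V2) (specials \<Gamma>) = take m (specials \<Gamma>)"
    using specials_part2_take[OF M adm] unfolding m_def specials_part2 .
  have "set (take m (specials \<Gamma>)) = V2 \<inter> set (specials \<Gamma>)"
    unfolding sp[symmetric] by auto
  then have eq: "V1 = set (drop m (specials \<Gamma>))"
    unfolding distinct_set_drop[OF distinct_specials] using V1 a(1,2)
    by (auto simp: internals_def)
  have "\<pi> = P (num_special \<Gamma> - m)"
    using m a(1,2) unfolding \<pi> P_def eq by auto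
  moreover have "num_special \<Gamma> - m \<in> ?J" using m fr eq by auto
  ultimately show "\<pi> \<in> P ` ?J" by blast
qed

end

section \<open>Values on tail graphs, normalised by sign, and their recursion\<close>

definition signed_tail :: "('v feynman_graph \<Rightarrow> complex) \<Rightarrow> 'v feynman_graph \<Rightarrow> nat \<Rightarrow> complex" where
  "signed_tail c \<Gamma> i = (-1) ^ num_regular (tail_graph \<Gamma> i) * c (tail_graph \<Gamma> i)"

text \<open>With the sign of the tail graph absorbed into \<open>signed_tail\<close>, the ansatz
  depends on \<Gamma> only through the sign of its own regular vertices and its last tail
  graph.\<close>

lemma sign_ansatz_signed_tail:
  assumes c: "sign_ansatz c" and M: "from_M \<Gamma>"
  shows "c \<Gamma> = (-1) ^ num_regular \<Gamma> * signed_tail c \<Gamma> (num_special \<Gamma>)"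
proof -
  let ?r = "num_regular (tail_graph \<Gamma> (num_special \<Gamma>))"
  have "?r \<le> num_regular \<Gamma>"
    unfolding num_regular_def using M regulars_tail_graph[OF M order.refl]
    by (intro card_mono) (auto simp: from_M_def)
  \<comment> \<open>As the subtraction does not truncate, the difference has the parity of the
    sum.\<close>
  then have "(-1 :: complex) ^ (num_regular \<Gamma> - ?r) = (-1) ^ num_regular \<Gamma> * (-1) ^ ?r"
    by (auto simp: minus_one_power_iff even_diff_nat)
  moreover have "c \<Gamma> = (-1) ^ (num_regular \<Gamma> - ?r) * c (tail_graph \<Gamma> (num_special \<Gamma>))"
    using c M unfolding sign_ansatz_def Let_def by blast
  ultimately show ?thesis by (simp add: signed_tail_def)
qed

text \<open>Every summand of the inversion equation carries the same sign, because splitting off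
  special vertices leaves all regular ones in the second part. What remains involves tail graphs of
  \<Gamma> only.\<close>

lemma sum_signed_tail:
  assumes inv: "inversion_equation c" and ans: "sign_ansatz c"
    and M: "from_M \<Gamma>" and nf: "no_frontal_regular \<Gamma>"
  shows "(\<Sum>j | j \<le> num_special \<Gamma> \<and> (\<forall>v \<in> set (drop (num_special \<Gamma> - j) (specials \<Gamma>)). frontal \<Gamma> v).
      signed_tail c \<Gamma> (num_special \<Gamma> - j) / fact j) = (if internals \<Gamma> = {} then 1 else 0)"
    (is "sum ?f ?J = ?d")
proof -
  define P where "P j = (set (drop (num_special \<Gamma> - j) (specials \<Gamma>)),
    internals \<Gamma> - set (drop (num_special \<Gamma> - j) (specials \<Gamma>)))" for j
  note P = admissible_from_N_eq_top[OF M nf] admissible_top[OF M] num_special_part1_top[OF M]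
    num_special_part2_top[OF M] regulars_part2_top[OF M] inj_on_top[OF M]
  note P = P[folded P_def]
  have summand: "c (part2 \<Gamma> (P j)) / fact (num_special (part1 \<Gamma> (P j))) = (-1) ^ num_regular \<Gamma> * ?f j"
    if j: "j \<in> ?J" for j
  proof -
    have adm: "admissible \<Gamma> (P j)" using j by (intro P(2)) auto
    then have "from_M (part2 \<Gamma> (P j))" using from_M_part2[OF M] unfolding P_def by blast
    then have "c (part2 \<Gamma> (P j)) = (-1) ^ num_regular \<Gamma> * signed_tail c (part2 \<Gamma> (P j)) (num_special \<Gamma> - j)"
      using sign_ansatz_signed_tail[OF ans] P(4,5) by (metis num_regular_def)
    moreover have "tail_graph (part2 \<Gamma> (P j)) (num_special \<Gamma> - j) = tail_graph \<Gamma> (num_special \<Gamma> - j)"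
      using tail_graph_part2[OF M, of "fst (P j)" "snd (P j)"] adm P(4)[of j] by simp
    ultimately show ?thesis using P(3)[of j] j by (simp add: signed_tail_def)
  qed
  have "d_fun \<Gamma> = fact (source_degree \<Gamma>) *
      (\<Sum>\<pi>\<in>P ` ?J. c (part2 \<Gamma> \<pi>) / fact (num_special (part1 \<Gamma> \<pi>)))"
    using inv M unfolding inversion_equation_def P(1)[symmetric] by blast
  also have "(\<Sum>\<pi>\<in>P ` ?J. c (part2 \<Gamma> \<pi>) / fact (num_special (part1 \<Gamma> \<pi>))) =
      (\<Sum>j\<in>?J. (-1) ^ num_regular \<Gamma> * ?f j)"
    by (subst sum.reindex) (auto intro!: inj_on_subset[OF P(6)] sum.cong simp: summand)
  also have "\<dots> = (-1) ^ num_regular \<Gamma> * sum ?f ?J" by (simp add: sum_distrib_left)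
  finally have eq: "d_fun \<Gamma> = fact (source_degree \<Gamma>) * ((-1) ^ num_regular \<Gamma> * sum ?f ?J)" .
  show ?thesis
  \<comment> \<open>Without internal vertices the sign is 1 and the factorials cancel; otherwise
    \<open>d_fun\<close> vanishes and the nonzero factors drop out.\<close>
  proof (cases "internals \<Gamma> = {}")
    case True
    then have "num_regular \<Gamma> = 0" by (simp add: num_regular_def internals_def)
    then show ?thesis using eq True by (simp add: d_fun_def)
  next
    case False
    then show ?thesis using eq by (simp add: d_fun_def)
  qed
qed

text \<open>The set of admissible lengths is finite, contains 0 and is closed under shortening the
  chain, so it consists of all numbers up to its maximum.\<close>

lemma chain_length_iff:
  "j \<le> chain_length \<Gamma> i \<longleftrightarrow>
    j \<le> i \<and> (\<forall>n \<in> {i - j..<i}. frontal (tail_graph \<Gamma> i) (specials \<Gamma> ! n))"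
proof -
  let ?L = "{l. l \<le> i \<and> (\<forall>j \<in> {i - l..<i}. frontal (tail_graph \<Gamma> i) (specials \<Gamma> ! j))}"
  have fin: "finite ?L" by (rule finite_subset[of _ "{..i}"]) auto
  have "0 \<in> ?L" by simp
  then have max: "chain_length \<Gamma> i \<in> ?L"
    unfolding chain_length_def using fin by (intro Max_in) auto
  have "j \<in> ?L" if "j \<le> chain_length \<Gamma> i" using max that by auto
  moreover have "j \<le> chain_length \<Gamma> i" if "j \<in> ?L"
    unfolding chain_length_def using fin that by (rule Max_ge)
  ultimately show ?thesis by blast
qed

text \<open>This is \<open>sum_signed_tail\<close> for the graph
  \<open>tail_graph \<Gamma> i\<close>, whose own tail graphs are those of \<Gamma>.\<close>

lemma signed_tail_recursion:
  assumes inv: "inversion_equation c" and ans: "sign_ansatz c"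
    and M: "from_M \<Gamma>" and i: "i \<le> num_special \<Gamma>"
  shows "(\<Sum>j\<le>chain_length \<Gamma> i. signed_tail c \<Gamma> (i - j) / fact j) = (if i = 0 then 1 else 0)"
proof -
  let ?D = "tail_graph \<Gamma> i"
  have D: "num_special ?D = i" "specials ?D = take i (specials \<Gamma>)"
    using num_special_tail_graph specials_tail_graph M i by blast+
  have len: "i \<le> length (specials \<Gamma>)" using i by (simp add: num_special_def)
  \<comment> \<open>Turns the last \<open>j\<close> of the first \<open>i\<close> special vertices
    into the index interval of \<open>chain_length\<close>.\<close>
  have "take i (specials \<Gamma>) = map ((!) (specials \<Gamma>)) [0..<i]"
    using len by (intro nth_equalityI) auto
  then have "set (drop (i - j) (take i (specials \<Gamma>))) = (!) (specials \<Gamma>) ` {i - j..<i}" for j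
    by (simp add: drop_map)
  then have J: "{j. j \<le> i \<and> (\<forall>v \<in> set (drop (i - j) (specials ?D)). frontal ?D v)} = {..chain_length \<Gamma> i}"
    unfolding D(2) by (auto simp: chain_length_iff)
  have empty: "internals ?D = {} \<longleftrightarrow> i = 0"
  proof
    assume "internals ?D = {}"
    then show "i = 0" using D(1) by (auto simp: internals_def num_special_def)
  next
    assume "i = 0"
    then show "internals ?D = {}"
      unfolding tail_graph_eq[OF M i] internals_part2 by (simp add: reach_def)
  qed
  have "signed_tail c ?D (i - j) = signed_tail c \<Gamma> (i - j)" for j
    using tail_graph_tail_graph[OF M _ i, of "i - j"] by (simp add: signed_tail_def)
  then show ?thesis
    using sum_signed_tail[OF inv ans from_M_tail_graph[OF M i] no_frontal_regular_tail_graph[OF M i]]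
    unfolding D(1) J empty by simp
qed

section \<open>Unrolling the recursion\<close>

text \<open>Here \<open>n\<close> counts steps, one more than the index used in
  \<open>chain_tuples\<close>. Allowing zero steps gives the base case for unrolling.\<close>

definition descents :: "(nat \<Rightarrow> nat) \<Rightarrow> nat \<Rightarrow> nat \<Rightarrow> nat list set" where
  "descents l m n = {ks. length ks = n + 1 \<and> ks ! 0 = m \<and> ks ! n = 0 \<and>
     (\<forall>i<n. l (ks ! i) \<ge> ks ! i - ks ! (i + 1) \<and> ks ! i - ks ! (i + 1) \<ge> 1)}"

lemma descents_0: "descents l m 0 = (if m = 0 then {[0]} else {})"
  by (auto simp: descents_def length_Suc_conv)

text \<open>Lists are sorted by their first step \<open>j\<close>. The bound
  \<open>l m \<le> m\<close> ensures that \<open>m - (m - j)\<close> is \<open>j\<close>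
  again.\<close>

lemma descents_Suc:
  assumes "l m \<le> m"
  shows "descents l m (Suc n) = (\<Union>j\<in>{1..l m}. Cons m ` descents l (m - j) n)"
proof (intro equalityI subsetI)
  fix ks assume ks: "ks \<in> descents l m (Suc n)"
  then obtain xs where xs: "ks = m # xs" by (auto simp: descents_def length_Suc_conv)
  \<comment> \<open>A positive difference is not truncated, so \<open>m - (m - xs ! 0)\<close>
    equals \<open>xs ! 0\<close>.\<close>
  have 0: "l m \<ge> m - xs ! 0" "m - xs ! 0 \<ge> 1" using ks xs by (auto simp: descents_def)
  have "xs \<in> descents l (m - (m - xs ! 0)) n"
    using ks 0(2) unfolding xs descents_def by fastforce
  then show "ks \<in> (\<Union>j\<in>{1..l m}. Cons m ` descents l (m - j) n)"
    using 0 xs by (intro UN_I[of "m - xs ! 0"]) auto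
next
  fix ks assume "ks \<in> (\<Union>j\<in>{1..l m}. Cons m ` descents l (m - j) n)"
  then obtain j xs where j: "1 \<le> j" "j \<le> l m" "ks = m # xs" "xs \<in> descents l (m - j) n" by auto
  then show "ks \<in> descents l m (Suc n)"
    using assms by (auto simp: descents_def nth_Cons split: nat.split)
qed

lemma finite_descents:
  assumes "\<And>m. l m \<le> m"
  shows "finite (descents l m n)"
  using assms by (induction n arbitrary: m) (simp_all add: descents_0 descents_Suc)

definition descent_sum :: "(nat \<Rightarrow> nat) \<Rightarrow> nat \<Rightarrow> nat \<Rightarrow> complex" where
  "descent_sum l m n = (\<Sum>ks\<in>descents l m n. (-1) ^ n / (\<Prod>i<n. fact (ks ! i - ks ! (i + 1))))"

lemma descent_sum_0: "descent_sum l m 0 = (if m = 0 then 1 else 0)"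
  by (simp add: descent_sum_def descents_0)

text \<open>The first step, of size \<open>j\<close>, contributes the factor -1 / j!, and the rest
  of the list is a descent from \<open>m - j\<close>.\<close>

lemma descent_sum_Suc:
  assumes l: "\<And>m. l m \<le> m"
  shows "descent_sum l m (Suc n) = - (\<Sum>j = 1..l m. descent_sum l (m - j) n / fact j)"
proof -
  let ?g = "\<lambda>n ks. (-1) ^ n / (\<Prod>i<n. fact (ks ! i - ks ! (i + 1))) :: complex"
  have hd: "xs ! 0 = m - j" if "xs \<in> descents l (m - j) n" for xs j
    using that by (simp add: descents_def)
  have "descent_sum l m (Suc n) = (\<Sum>j = 1..l m. \<Sum>ks\<in>Cons m ` descents l (m - j) n. ?g (Suc n) ks)"
    unfolding descent_sum_def descents_Suc[of l m, OF l]
  proof (rule sum.UNION_disjoint)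
    \<comment> \<open>The entry after \<open>m\<close> determines the step, as steps up to
      \<open>l m \<le> m\<close> are not truncated.\<close>
    show "\<forall>i\<in>{1..l m}. \<forall>j\<in>{1..l m}. i \<noteq> j \<longrightarrow>
        Cons m ` descents l (m - i) n \<inter> Cons m ` descents l (m - j) n = {}"
    proof (intro ballI impI)
      fix i j assume ij: "i \<in> {1..l m}" "j \<in> {1..l m}" "i \<noteq> j"
      then have "m - i \<noteq> m - j" using l[of m] by auto
      then have "descents l (m - i) n \<inter> descents l (m - j) n = {}"
        using hd by (metis disjoint_iff)
      then show "Cons m ` descents l (m - i) n \<inter> Cons m ` descents l (m - j) n = {}"
        by auto
    qed
  qed (simp_all add: finite_descents l)
  also have "\<dots> = (\<Sum>j = 1..l m. - (descent_sum l (m - j) n / fact j))"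
  proof (rule sum.cong)
    fix j assume j: "j \<in> {1..l m}"
    have "?g (Suc n) (m # xs) = - (?g n xs / fact j)" if "xs \<in> descents l (m - j) n" for xs
    proof -
      have "m - xs ! 0 = j" using hd[OF that] j l[of m] by auto
      then show ?thesis by (simp add: prod.lessThan_Suc_shift del: prod.lessThan_Suc)
    qed
    then show "(\<Sum>ks\<in>Cons m ` descents l (m - j) n. ?g (Suc n) ks) = - (descent_sum l (m - j) n / fact j)"
      by (simp add: sum.reindex descent_sum_def sum_negf sum_divide_distrib)
  qed simp
  finally show ?thesis by (simp add: sum_negf)
qed

text \<open>Each step lowers the value by at least 1, so a descent from \<open>m\<close> has at most
  \<open>m\<close> steps and any cutoff \<open>N \<ge> m\<close> captures them all. This lets the
  induction run on \<open>N\<close> with \<open>m\<close> arbitrary.\<close>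

lemma recursion_eq_descent_sum:
  fixes a :: "nat \<Rightarrow> complex"
  assumes l: "\<And>m. l m \<le> m"
    and rec: "\<And>m. m \<le> k \<Longrightarrow> (\<Sum>j\<le>l m. a (m - j) / fact j) = (if m = 0 then 1 else 0)"
    and "m \<le> k" "m \<le> N"
  shows "a m = (\<Sum>n\<le>N. descent_sum l m n)"
  using assms(3,4)
proof (induction N arbitrary: m)
  case 0
  then show ?case using rec[of 0] l[of 0] by (simp add: descent_sum_0)
next
  case (Suc N)
  have "{..l m} = insert 0 {1..l m}" by auto
  then have split: "(\<Sum>j\<le>l m. a (m - j) / fact j) = a m + (\<Sum>j = 1..l m. a (m - j) / fact j)"
    by simp
  have "(\<Sum>n\<le>Suc N. descent_sum l m n) = (if m = 0 then 1 else 0) +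
      (\<Sum>n\<le>N. - (\<Sum>j = 1..l m. descent_sum l (m - j) n / fact j))"
    \<comment> \<open>The term with zero steps is the right-hand side of the recursion; the other
      terms are unrolled by one step.\<close>
    unfolding sum.atMost_Suc_shift by (simp add: descent_sum_0 descent_sum_Suc l)
  also have "(\<Sum>n\<le>N. - (\<Sum>j = 1..l m. descent_sum l (m - j) n / fact j)) =
      - (\<Sum>j = 1..l m. (\<Sum>n\<le>N. descent_sum l (m - j) n) / fact j)"
    unfolding sum_negf sum_divide_distrib by (subst sum.swap) simp
  also have "(\<Sum>j = 1..l m. (\<Sum>n\<le>N. descent_sum l (m - j) n) / fact j) =
      (\<Sum>j = 1..l m. a (m - j) / fact j)"
    \<comment> \<open>Since \<open>j \<ge> 1\<close>, the value \<open>m - j\<close> is within the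
      smaller cutoff.\<close>
    using Suc by (intro sum.cong refl arg_cong2[of _ _ _ _ "(/)"] Suc.IH[symmetric]) auto
  also have "(if m = 0 then 1 else 0) + - (\<Sum>j = 1..l m. a (m - j) / fact j) = a m"
    unfolding rec[OF Suc.prems(1), symmetric] split by simp
  finally show ?case ..
qed

theorem theorem5:
  fixes c :: "nat feynman_graph \<Rightarrow> complex" and \<Gamma> :: "nat feynman_graph" and k :: nat
  assumes "iso_invariant c"
    and "inversion_equation c"
    and "sign_ansatz c"
    and "from_M \<Gamma>"
    and "num_special \<Gamma> = k"
  shows "(k = 0 \<longrightarrow> c \<Gamma> = (-1) ^ num_regular \<Gamma>) \<and>
         (k \<ge> 1 \<longrightarrow> c \<Gamma> =
            (\<Sum>n = 0..k - 1. \<Sum>ks \<in> chain_tuples \<Gamma> n.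
               (-1) ^ (num_regular \<Gamma> + n + 1) / (\<Prod>i = 0..n. fact (ks ! i - ks ! (i + 1)))))"
proof -
  let ?l = "chain_length \<Gamma>"
  have l: "?l m \<le> m" for m using chain_length_iff[of "?l m" \<Gamma> m] by simp
  have "signed_tail c \<Gamma> k = (\<Sum>n\<le>k. descent_sum ?l k n)"
    using signed_tail_recursion[OF assms(2-4)] assms(5) l
    by (intro recursion_eq_descent_sum[where k = k]) simp_all
  then have c: "c \<Gamma> = (-1) ^ num_regular \<Gamma> * (\<Sum>n\<le>k. descent_sum ?l k n)"
    using sign_ansatz_signed_tail[OF assms(3,4)] assms(5) by simp
  show ?thesis
  proof (intro conjI impI)
    assume "k = 0"
    then show "c \<Gamma> = (-1) ^ num_regular \<Gamma>" using c by (simp add: descent_sum_0)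
  next
    assume "k \<ge> 1"
    then obtain k' where k': "k = Suc k'" by (cases k) auto
    \<comment> \<open>A tuple with \<open>n + 2\<close> entries makes \<open>n + 1\<close>
      steps.\<close>
    have tuples: "chain_tuples \<Gamma> n = descents ?l k (Suc n)" for n
      unfolding chain_tuples_def descents_def assms(5) by (simp add: less_Suc_eq_le)
    \<comment> \<open>The term with zero steps vanishes because \<open>k\<close> is positive, which
      leaves the range of \<open>n\<close> in the statement after a shift by one.\<close>
    have "(\<Sum>n\<le>k. descent_sum ?l k n) = (\<Sum>n = 0..k - 1. descent_sum ?l k (Suc n))"
      unfolding k' sum.atMost_Suc_shift by (simp add: descent_sum_0 atMost_atLeast0)
    then have "c \<Gamma> = (\<Sum>n = 0..k - 1. (-1) ^ num_regular \<Gamma> * descent_sum ?l k (Suc n))"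
      unfolding c by (simp add: sum_distrib_left)
    also have "\<dots> = (\<Sum>n = 0..k - 1. \<Sum>ks \<in> chain_tuples \<Gamma> n.
               (-1) ^ (num_regular \<Gamma> + n + 1) / (\<Prod>i = 0..n. fact (ks ! i - ks ! (i + 1))))"
      unfolding descent_sum_def tuples sum_distrib_left
      by (simp add: power_add lessThan_Suc_atMost atMost_atLeast0 del: prod.lessThan_Suc)
    finally show "c \<Gamma> = (\<Sum>n = 0..k - 1. \<Sum>ks \<in> chain_tuples \<Gamma> n.
               (-1) ^ (num_regular \<Gamma> + n + 1) / (\<Prod>i = 0..n. fact (ks ! i - ks ! (i + 1))))" .
  qed
qed

end
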